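(* Let $X$ be a complex Hilbert space and let $T$ and $S$ be Hermitian subspaces in $X^2$ with $D(T)\subset D(S)$ and $S(0)\subset T(0)$. If $S$ is $T$-bounded with $T$-bound less than $1$, then $d_+(T+S)=d_+(T)$ and $d_-(T+S)=d_-(T)$.
   Context: A subspace (linear relation) in $X^2=X\times X$ is a linear subspace $T\subset X\times X$, not necessarily closed. Domain: $D(T)=\{x:(x,f)\in T\text{ for some }f\in X\}$; range: $R(T)=\{f:(x,f)\in T\text{ for some }x\in X\}$; $T(x)=\{f\in X:(x,f)\in T\}$. For $\alpha\in\mathbf{C}$, $\alpha T=\{(x,\alpha f):(x,f)\in T\}$; $T+S=\{(x,f+g):(x,f)\in T,(x,g)\in S\}$; $I=\{(x,x):x\in X\}$. The adjoint is $T^*=\{(y,g)\in X^2:\langle g,x\rangle=\langle y,f\rangle\text{ for all }(x,f)\in T\}$. $T$ is Hermitian if $T\subset T^*$ (no density of the domain is assumed). Norm at a point: for $x\in D(T)$, $\|T(x)\|$ is the norm in the quotient space $X/\overline{T(0)}$ of the class of any $f\in T(x)$; equivalently $\|T(x)\|=\mathrm{dist}(f,T(0))$ for any $f\in T(x)$. $S$ is $T$-bounded if $D(T)\subset D(S)$ and there is a constant $c\ge 0$ with $\|S(x)\|\le c(\|x\|+\|T(x)\|)$ for all $x\in D(T)$. In that case the $T$-bound of $S$ is the infimum of all $b\ge0$ for which there exists $a\ge0$ with $\|S(x)\|\le a\|x\|+b\|T(x)\|$ for all $x\in D(T)$. Deficiency indices of a Hermitian subspace $T$: $d_{\pm}(T)=\dim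 R(T\mp iI)^{\perp}$, with values in $\{0,1,2,\dots\}\cup\{+\infty\}$. *)

theory Defs
  imports "HOL-Analysis.Analysis" "HOL-Library.Extended_Nat"
begin


class complex_vector = real_vector +
  fixes scaleC :: "complex \<Rightarrow> 'a \<Rightarrow> 'a"  (infixr "*\<^sub>C" 75)
  assumes scaleC_add_right: "a *\<^sub>C (x + y) = a *\<^sub>C x + a *\<^sub>C y"
    and scaleC_add_left: "(a + b) *\<^sub>C x = a *\<^sub>C x + b *\<^sub>C x"
    and scaleC_scaleC: "a *\<^sub>C b *\<^sub>C x = (a * b) *\<^sub>C x"
    and scaleC_one: "1 *\<^sub>C x = x"
    and scaleR_scaleC: "r *\<^sub>R x = complex_of_real r *\<^sub>C x"

global_interpretation complex_vector: vector_space "scaleC :: complex \<Rightarrow> 'a \<Rightarrow> 'a::complex_vector"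
  defines csubspace = complex_vector.subspace
    and cspan = complex_vector.span
    and cdim = complex_vector.dim
  by unfold_locales (rule scaleC_add_right scaleC_add_left scaleC_scaleC scaleC_one)+

instantiation prod :: (complex_vector, complex_vector) complex_vector
begin

definition scaleC_prod_def: "a *\<^sub>C p = (a *\<^sub>C fst p, a *\<^sub>C snd p)"

instance
  by standard
    (simp_all add: scaleC_prod_def scaleR_prod_def scaleC_add_right scaleC_add_left
      scaleC_scaleC scaleC_one scaleR_scaleC)

end

text \<open>The inner product is linear in the first argument. The norm, with its topology, is inherited
  from \<^class>\<open>real_normed_vector\<close>; its axioms are redundant given the ones below.\<close>

class complex_inner = complex_vector + real_normed_vector +
  fixes cinner :: "'a \<Rightarrow> 'a \<Rightarrow> complex"
  assumes cinner_commute: "cinner x y = cnj (cinner y x)"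
    and cinner_add_left: "cinner (x + y) z = cinner x z + cinner y z"
    and cinner_scaleC_left: "cinner (a *\<^sub>C x) y = a * cinner x y"
    and cinner_self_nonneg: "0 \<le> Re (cinner x x)"
    and cinner_eq_zero_iff: "cinner x x = 0 \<longleftrightarrow> x = 0"
    and norm_eq_sqrt_cinner: "norm x = sqrt (Re (cinner x x))"

class complex_hilbert_space = complex_inner + complete_space

definition corthogonal_comp :: "'a::complex_inner set \<Rightarrow> 'a set" where
  "corthogonal_comp A = {y. \<forall>x\<in>A. cinner x y = 0}"

text \<open>\<^const>\<open>cdim\<close> is 0 on infinite-dimensional subspaces, whence the case distinction.\<close>

definition ecdim :: "'a::complex_vector set \<Rightarrow> enat" where
  "ecdim V = (if \<exists>B. finite B \<and> cspan B = V then enat (cdim V) else \<infinity>)"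



text \<open>A linear relation is a set of pairs satisfying \<^const>\<open>csubspace\<close>; its domain, range and
  value at \<open>x\<close> are \<open>Domain T\<close>, \<open>Range T\<close> and \<open>T `` {x}\<close>, and \<open>I\<close> is \<^const>\<open>Id\<close>.\<close>

definition rel_scale :: "complex \<Rightarrow> ('a \<times> 'a) set \<Rightarrow> ('a::complex_vector \<times> 'a) set" where
  "rel_scale \<alpha> T = {(x, \<alpha> *\<^sub>C f) | x f. (x, f) \<in> T}"

definition rel_plus :: "('a \<times> 'a) set \<Rightarrow> ('a \<times> 'a) set \<Rightarrow> ('a::complex_vector \<times> 'a) set" where
  "rel_plus T S = {(x, f + g) | x f g. (x, f) \<in> T \<and> (x, g) \<in> S}"

definition rel_adjoint :: "('a \<times> 'a) set \<Rightarrow> ('a::complex_inner \<times> 'a) set" where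
  "rel_adjoint T = {(y, g). \<forall>(x, f)\<in>T. cinner g x = cinner y f}"

definition hermitian_subspace :: "('a::complex_inner \<times> 'a) set \<Rightarrow> bool" where
  "hermitian_subspace T \<longleftrightarrow> csubspace T \<and> T \<subseteq> rel_adjoint T"

text \<open>The norm of the class of \<open>f\<close> in the quotient by a closed subspace \<open>M\<close> is \<open>infdist f M\<close>.
  The choice of \<open>f\<close> is immaterial and the closure may be dropped, see \<open>rel_norm_eq\<close> below.\<close>

definition rel_norm :: "('a \<times> 'a) set \<Rightarrow> 'a::complex_inner \<Rightarrow> real" where
  "rel_norm T x = infdist (SOME f. f \<in> T `` {x}) (closure (T `` {0}))"

lemma rel_norm_eq:
  assumes T: "csubspace T" and f: "(x, f) \<in> T"
  shows "rel_norm T x = infdist f (T `` {0})"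
proof -
  have zero: "(0, 0) \<in> T"
    using complex_vector.subspace_0[OF T] by (simp add: zero_prod_def)
  have le: "infdist g (T `` {0}) \<le> infdist h (T `` {0})"
    if g: "(x, g) \<in> T" and h: "(x, h) \<in> T" for g h
  proof -
    have gh: "(0, g - h) \<in> T"
      using complex_vector.subspace_diff[OF T g h] by simp
    have "infdist g (T `` {0}) \<le> dist h a" if "a \<in> T `` {0}" for a
    proof -
      have "(0, (g - h) + a) \<in> T"
        using complex_vector.subspace_add[OF T gh] that by fastforce
      then have "infdist g (T `` {0}) \<le> dist g ((g - h) + a)"
        by (intro infdist_le) auto
      then show ?thesis by (simp add: dist_norm algebra_simps)
    qed
    then show ?thesis
      using zero by (subst (2) infdist_notempty) (auto intro!: cINF_greatest)
  qed
  have "(x, SOME f. f \<in> T `` {x}) \<in> T"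
    using f someI[of "\<lambda>f. f \<in> T `` {x}" f] by auto
  with f le show ?thesis
    unfolding rel_norm_def by (metis infdist_eq_setdist setdist_closure_2 antisym)
qed

definition rel_bounded :: "('a \<times> 'a) set \<Rightarrow> ('a::complex_inner \<times> 'a) set \<Rightarrow> bool" where
  "rel_bounded T S \<longleftrightarrow> Domain T \<subseteq> Domain S \<and>
     (\<exists>c\<ge>0. \<forall>x\<in>Domain T. rel_norm S x \<le> c * (norm x + rel_norm T x))"

text \<open>Only meaningful if \<open>rel_bounded T S\<close> holds; otherwise the set may be empty.\<close>

definition rel_bound :: "('a \<times> 'a) set \<Rightarrow> ('a::complex_inner \<times> 'a) set \<Rightarrow> real" where
  "rel_bound T S = Inf {b. b \<ge> 0 \<and>
     (\<exists>a\<ge>0. \<forall>x\<in>Domain T. rel_norm S x \<le> a * norm x + b * rel_norm T x)}"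

definition deficiency_plus :: "('a::complex_inner \<times> 'a) set \<Rightarrow> enat" where
  "deficiency_plus T = ecdim (corthogonal_comp (Range (rel_plus T (rel_scale (- \<i>) Id))))"

definition deficiency_minus :: "('a::complex_inner \<times> 'a) set \<Rightarrow> enat" where
  "deficiency_minus T = ecdim (corthogonal_comp (Range (rel_plus T (rel_scale \<i> Id))))"

end

theory Submission
  imports Defs
begin

text \<open>
  For a Hermitian relation \<open>T\<close> and \<open>(x, f) \<in> T\<close> the number \<open>\<langle>f, x\<rangle>\<close> is real, so
  \<open>\<parallel>f + cx\<parallel>\<^sup>2 = \<parallel>f\<parallel>\<^sup>2 + \<bar>c\<bar>\<^sup>2\<parallel>x\<parallel>\<^sup>2\<close> for every imaginary \<open>c\<close>. If \<open>S\<close> has \<open>T\<close>-bound less than \<open>1\<close>, then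
  \<open>x\<close> has an image \<open>g\<close> under \<open>S\<close> with \<open>\<parallel>g\<parallel> \<le> a\<parallel>x\<parallel> + b\<parallel>f\<parallel> \<le> (a/\<bar>c\<bar> + b)\<parallel>f + cx\<parallel>\<close>, and the factor
  \<open>a/\<bar>c\<bar> + b\<close> is below \<open>1\<close> once \<open>\<bar>c\<bar>\<close> is large. So far from the real axis \<open>S\<close> is a strict relative
  contraction of \<open>T + cI\<close>.

  Strict relative contractions do not change the dimension of the orthogonal complement of the
  range (\<open>ecdim_corthogonal_comp_eq\<close>). Indeed, if one complement had the larger dimension, it would
  contain a nonzero \<open>y\<close> orthogonal to the other one, that is, \<open>y\<close> would be orthogonal to one
  of the ranges and in the closure of the other. The contraction constant keeps the ranges too close
  together for that. The closure appears here through the projection theorem, and this is where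
  completeness enters.

  Finally, replacing the large \<open>c = \<plusminus>ir\<close> by \<open>\<plusminus>i\<close> is itself a relative contraction, of factor
  \<open>(r - 1)/r\<close>, for \<open>T\<close> as well as for \<open>T + S\<close>. Hence both deficiency indices survive the three steps
  from \<open>T \<plusminus> i\<close> to \<open>T \<plusminus> ir\<close>, to \<open>T + S \<plusminus> ir\<close>, and to \<open>T + S \<plusminus> i\<close>.
\<close>

section \<open>Inner products\<close>

lemma cnj_cinner: "cnj (cinner x y) = cinner y x"
  by (rule cinner_commute[symmetric])

lemma cinner_scaleC_right: "cinner x (a *\<^sub>C y) = cnj a * cinner x y"
  using cinner_commute[of x "a *\<^sub>C y"] by (simp add: cinner_scaleC_left cnj_cinner)

lemma cinner_add_right: "cinner x (y + z) = cinner x y + cinner x z"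
  using cinner_commute[of x "y + z"] by (simp add: cinner_add_left cnj_cinner)

lemma scaleC_minus1: "(- 1) *\<^sub>C x = - (x :: 'a::complex_vector)"
  using complex_vector.scale_minus_left[of 1 x] by (simp add: scaleC_one)

lemma cinner_minus_left: "cinner (- x) y = - cinner x y"
  using cinner_scaleC_left[of "- 1" x y] by (simp add: scaleC_minus1)

lemma cinner_minus_right: "cinner x (- y) = - cinner x y"
  using cinner_scaleC_right[of x "- 1" y] by (simp add: scaleC_minus1)

lemma cinner_diff_left: "cinner (x - y) z = cinner x z - cinner y z"
  using cinner_add_left[of x "- y" z] by (simp add: cinner_minus_left)

lemma cinner_zero_left [simp]: "cinner 0 x = 0"
  using cinner_scaleC_left[of 0 0 x] by simp

lemma cinner_zero_right [simp]: "cinner x 0 = 0"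
  using cinner_scaleC_right[of x 0 0] by simp

lemma norm_sq_cinner: "(norm x)\<^sup>2 = Re (cinner x x)"
  by (simp add: norm_eq_sqrt_cinner cinner_self_nonneg)

lemma norm_scaleC: "norm (a *\<^sub>C x) = cmod a * norm (x :: 'a::complex_inner)"
proof -
  have "cinner (a *\<^sub>C x) (a *\<^sub>C x) = of_real ((cmod a)\<^sup>2) * cinner x x"
    unfolding complex_norm_square by (simp add: cinner_scaleC_left cinner_scaleC_right mult_ac)
  then have "(norm (a *\<^sub>C x))\<^sup>2 = (cmod a * norm x)\<^sup>2"
    unfolding norm_sq_cinner power_mult_distrib by simp
  then show ?thesis by (metis norm_ge_zero mult_nonneg_nonneg power2_eq_imp_eq)
qed

lemma norm_add_sq: "(norm (x + y))\<^sup>2 = (norm x)\<^sup>2 + (norm y)\<^sup>2 + 2 * Re (cinner x y)"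
  for x y :: "'a::complex_inner"
proof -
  have "Re (cinner y x) = Re (cinner x y)" by (simp flip: cnj_cinner[of x y])
  then show ?thesis by (simp add: norm_sq_cinner cinner_add_left cinner_add_right)
qed

lemma norm_diff_sq: "(norm (x - y))\<^sup>2 = (norm x)\<^sup>2 + (norm y)\<^sup>2 - 2 * Re (cinner x y)"
  for x y :: "'a::complex_inner"
  using norm_add_sq[of x "- y"] by (simp add: cinner_minus_right)

lemma cinner_eq_zero_commute: "cinner x y = 0 \<longleftrightarrow> cinner y x = 0"
  using cnj_cinner[of x y] by (metis complex_cnj_zero_iff)

section \<open>Orthogonal complements and the projection theorem\<close>

lemma csubspace_corthogonal_comp: "csubspace (corthogonal_comp A)"
  by (auto simp: corthogonal_comp_def complex_vector.subspace_def cinner_add_right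
      cinner_scaleC_right)

text \<open>The difference between a point and its nearest point in a subspace is orthogonal to the
  subspace.\<close>

lemma cinner_eq_zero_if_minimal:
  fixes w v :: "'a::complex_inner"
  assumes "\<And>s. norm w \<le> norm (w - s *\<^sub>C v)"
  shows "cinner v w = 0"
proof -
  define p where "p = cinner w v"
  define t where "t = 1 / (1 + (norm v)\<^sup>2)"
  \<comment> \<open>If \<open>p \<noteq> 0\<close>, subtracting \<open>t * p\<close> times \<open>v\<close> shortens \<open>w\<close> whenever \<open>0 < t < 2 / (norm v)\<^sup>2\<close>;
    adding \<open>1\<close> in the denominator avoids a separate treatment of \<open>v = 0\<close>.\<close>
  have pos: "1 + (norm v)\<^sup>2 > 0" by (simp add: add_pos_nonneg)
  have t: "t > 0" "t * (norm v)\<^sup>2 < 1" using pos by (auto simp: t_def divide_simps)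
  have "(norm w)\<^sup>2 \<le> (norm (w - (of_real t * p) *\<^sub>C v))\<^sup>2"
    using assms by (simp add: power_mono)
  also have "\<dots> = (norm w)\<^sup>2 + t\<^sup>2 * (cmod p)\<^sup>2 * (norm v)\<^sup>2 - 2 * t * (cmod p)\<^sup>2"
  proof -
    have "Re (cinner w ((of_real t * p) *\<^sub>C v)) = t * (cmod p)\<^sup>2"
      unfolding cmod_power2
      by (simp add: cinner_scaleC_right p_def[symmetric] power2_eq_square algebra_simps)
    then show ?thesis
      using t by (simp add: norm_diff_sq norm_scaleC norm_mult power_mult_distrib)
  qed
  finally have "0 \<le> (t * (cmod p)\<^sup>2) * (t * (norm v)\<^sup>2 - 2)"
    by (simp add: algebra_simps power2_eq_square)
  moreover have "t * (norm v)\<^sup>2 - 2 < 0" using t by simp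
  ultimately have "t * (cmod p)\<^sup>2 \<le> 0" by (simp add: zero_le_mult_iff)
  then have "p = 0" using t by (simp add: mult_le_0_iff)
  then show ?thesis by (simp add: p_def cinner_eq_zero_commute)
qed

text \<open>The parallelogram law makes a minimising sequence for the distance from \<open>y\<close> to \<open>V\<close> a Cauchy
  sequence, and its limit is the orthogonal projection.\<close>

lemma projection_onto_closure:
  fixes y :: "'a::complex_hilbert_space"
  assumes V: "csubspace V"
  obtains z where "z \<in> closure V" "y - z \<in> corthogonal_comp V"
proof -
  define d where "d = infdist y V"
  have V0: "0 \<in> V" using V by (rule complex_vector.subspace_0)
  have d0: "d \<ge> 0" by (simp add: d_def infdist_nonneg)
  have d_le: "d \<le> norm (y - v)" if "v \<in> V" for v
    using infdist_le[OF that, of y] by (simp add: d_def dist_norm)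
  have "\<exists>v\<in>V. (norm (y - v))\<^sup>2 < d\<^sup>2 + e" if "e > 0" for e
  proof -
    have "infdist y V < sqrt (d\<^sup>2 + e)"
      using that d0 by (simp add: d_def[symmetric] real_less_rsqrt)
    then have "(INF v\<in>V. dist y v) < sqrt (d\<^sup>2 + e)"
      using V0 by (subst (asm) infdist_notempty) auto
    then obtain v where "v \<in> V" "dist y v < sqrt (d\<^sup>2 + e)"
      using V0 cInf_lessD[of "dist y ` V"] by blast
    then show ?thesis
      by (metis dist_norm norm_ge_zero real_sqrt_less_iff real_sqrt_abs abs_of_nonneg)
  qed
  then have "\<forall>n. \<exists>v. v \<in> V \<and> (norm (y - v))\<^sup>2 < d\<^sup>2 + inverse (real (Suc n))"
    by (metis inverse_positive_iff_positive of_nat_0_less_iff zero_less_Suc)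
  then obtain v where v: "v n \<in> V" "(norm (y - v n))\<^sup>2 < d\<^sup>2 + inverse (real (Suc n))" for n
    by metis
  have para: "(norm (v m - v n))\<^sup>2
      \<le> 2 * inverse (real (Suc m)) + 2 * inverse (real (Suc n))" for m n
  proof -
    define p q where "p = y - v m" and "q = y - v n"
    have "v m + v n \<in> V" using V v complex_vector.subspace_add by blast
    then have mid: "(1/2) *\<^sub>R (v m + v n) \<in> V"
      using V complex_vector.subspace_scale by (metis scaleR_scaleC)
    have "p + q = 2 *\<^sub>R (y - (1/2) *\<^sub>R (v m + v n))"
      by (simp add: p_def q_def scaleR_right_diff_distrib scaleR_2)
    then have "2 * d \<le> norm (p + q)" using d_le[OF mid] by simp
    then have "(2 * d)\<^sup>2 \<le> (norm (p + q))\<^sup>2" using d0 by (intro power_mono) auto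
    moreover have "(norm (p + q))\<^sup>2 + (norm (p - q))\<^sup>2 = 2 * (norm p)\<^sup>2 + 2 * (norm q)\<^sup>2"
      by (simp add: norm_add_sq norm_diff_sq)
    moreover have "norm (v m - v n) = norm (p - q)"
      by (simp add: p_def q_def norm_minus_commute)
    ultimately show ?thesis
      using v(2)[of m] v(2)[of n] by (simp add: p_def q_def power_mult_distrib)
  qed
  have "Cauchy v"
  proof (rule metric_CauchyI)
    fix e :: real assume e: "e > 0"
    then obtain N where N: "inverse (real (Suc N)) < e\<^sup>2 / 4"
      using reals_Archimedean[of "e\<^sup>2 / 4"] by auto
    have "dist (v m) (v n) < e" if "m \<ge> N" "n \<ge> N" for m n
    proof -
      have "inverse (real (Suc m)) \<le> inverse (real (Suc N))"
        "inverse (real (Suc n)) \<le> inverse (real (Suc N))"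
        using that by (simp_all add: le_imp_inverse_le)
      then have "(norm (v m - v n))\<^sup>2 < e\<^sup>2" using para[of m n] N by linarith
      then show ?thesis using e by (simp add: dist_norm power2_less_imp_less[of _ e])
    qed
    then show "\<exists>M. \<forall>m\<ge>M. \<forall>n\<ge>M. dist (v m) (v n) < e" by blast
  qed
  then obtain z where z: "v \<longlonglongrightarrow> z" by (meson Cauchy_convergent_iff convergent_def)
  have "(\<lambda>n. (norm (y - v n))\<^sup>2) \<longlonglongrightarrow> (norm (y - z))\<^sup>2" by (intro tendsto_intros z)
  moreover have "(\<lambda>n. d\<^sup>2 + inverse (real (Suc n))) \<longlonglongrightarrow> d\<^sup>2 + 0"
    by (intro tendsto_intros LIMSEQ_inverse_real_of_nat)
  ultimately have "(norm (y - z))\<^sup>2 \<le> d\<^sup>2"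
    using v(2) by (intro LIMSEQ_le[of "\<lambda>n. (norm (y - v n))\<^sup>2"]) (auto intro: less_imp_le)
  then have le: "norm (y - z) \<le> d" using d0 by (rule power2_le_imp_le)
  have "cinner u (y - z) = 0" if u: "u \<in> V" for u
  proof (rule cinner_eq_zero_if_minimal)
    fix s
    have "(\<lambda>n. norm (y - (v n + s *\<^sub>C u))) \<longlonglongrightarrow> norm (y - (z + s *\<^sub>C u))"
      by (intro tendsto_intros z)
    moreover have "d \<le> norm (y - (v n + s *\<^sub>C u))" for n
      using u v(1) V by (intro d_le) (simp add: complex_vector.subspace_add complex_vector.subspace_scale)
    ultimately have "d \<le> norm (y - (z + s *\<^sub>C u))" by (intro LIMSEQ_le_const) auto
    then show "norm (y - z) \<le> norm (y - z - s *\<^sub>C u)" using le by (simp add: diff_diff_eq)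
  qed
  then have "y - z \<in> corthogonal_comp V" by (simp add: corthogonal_comp_def)
  moreover have "z \<in> closure V" using v(1) z closure_sequential by blast
  ultimately show ?thesis using that by blast
qed

lemma in_closure_if_orthogonal_to_comp:
  fixes y :: "'a::complex_hilbert_space"
  assumes V: "csubspace V" and y: "\<And>u. u \<in> corthogonal_comp V \<Longrightarrow> cinner y u = 0"
  shows "y \<in> closure V"
proof -
  obtain z where z: "z \<in> closure V" "y - z \<in> corthogonal_comp V"
    using projection_onto_closure[OF V] .
  define w where "w = y - z"
  have yw: "cinner y w = 0" using y z by (simp add: w_def)
  have "norm w < e" if e: "e > 0" for e
  proof -
    obtain v where v: "v \<in> V" "dist v z < e"
      using z(1) e unfolding closure_approachable by blast
    have "cinner v w = 0" using v(1) z(2) by (auto simp: w_def corthogonal_comp_def)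
    \<comment> \<open>\<open>y\<close> and \<open>v\<close> are orthogonal to \<open>w\<close>, so \<open>w\<close> is a leg of the right triangle with
      hypotenuse \<open>z - v = (y - v) - w\<close>.\<close>
    then have "(norm (y - v - w))\<^sup>2 = (norm (y - v))\<^sup>2 + (norm w)\<^sup>2"
      using yw by (simp add: norm_diff_sq[of "y - v" w] cinner_diff_left)
    then have "norm w \<le> norm (y - v - w)"
      by - (rule power2_le_imp_le, auto)
    also have "\<dots> = dist v z" by (simp add: w_def dist_norm norm_minus_commute)
    finally show ?thesis using v by simp
  qed
  from this[of "norm w"] have "norm w = 0" by fastforce
  then show ?thesis using z by (simp add: w_def)
qed

section \<open>Comparing dimensions by orthogonality\<close>

text \<open>A subspace separated by \<open>card B\<close> linear functionals has at most that dimension: passing to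
  the kernel of one functional costs at most one spanning vector.\<close>

lemma finite_spanning_set_if_separated:
  fixes V :: "'a::complex_inner set"
  assumes "finite B" "csubspace V" "\<And>v. v \<in> V \<Longrightarrow> (\<forall>b\<in>B. cinner v b = 0) \<Longrightarrow> v = 0"
  shows "\<exists>C. finite C \<and> card C \<le> card B \<and> cspan C = V"
  using assms
proof (induction B arbitrary: V rule: finite_induct)
  case empty
  then have "V = {0}" using complex_vector.subspace_0 by auto
  then show ?case by (intro exI[of _ "{}"]) simp
next
  case (insert b B)
  define K where "K = {v \<in> V. cinner v b = 0}"
  have K: "csubspace K"
    using insert.prems(1)
    by (auto simp: K_def complex_vector.subspace_def cinner_add_left cinner_scaleC_left)
  have "v = 0" if "v \<in> K" "\<forall>b\<in>B. cinner v b = 0" for v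
    using insert.prems(2)[of v] that by (auto simp: K_def)
  from insert.IH[OF K this] obtain C where C: "finite C" "card C \<le> card B" "cspan C = K"
    by auto
  show ?case
  proof (cases "K = V")
    case True
    then show ?thesis using C insert.hyps by (intro exI[of _ C]) auto
  next
    case False
    then obtain a where a: "a \<in> V" "cinner a b \<noteq> 0" by (auto simp: K_def)
    have "cspan (insert a C) = V"
    proof
      have "C \<subseteq> V" using C complex_vector.span_superset[of C] by (auto simp: K_def)
      then show "cspan (insert a C) \<subseteq> V"
        using a insert.prems(1) by (intro complex_vector.span_minimal) auto
    next
      show "V \<subseteq> cspan (insert a C)"
      proof
        fix v assume v: "v \<in> V"
        define k where "k = cinner v b / cinner a b"
        have "v - k *\<^sub>C a \<in> K"
          using v a insert.prems(1)
          by (auto simp: K_def k_def cinner_diff_left cinner_scaleC_left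
              complex_vector.subspace_diff complex_vector.subspace_scale)
        then have "v - k *\<^sub>C a \<in> cspan C" using C by simp
        then show "v \<in> cspan (insert a C)" by (metis complex_vector.span_breakdown_eq)
      qed
    qed
    moreover have "card (insert a C) \<le> card (insert b B)"
      using C insert.hyps card_insert_le_m1[of "Suc (card B)" C a] by simp
    ultimately show ?thesis using C by blast
  qed
qed

lemma ecdim_le_if_no_orthogonal:
  fixes M N :: "'a::complex_inner set"
  assumes M: "csubspace M" and N: "csubspace N"
    and orth: "\<And>y. y \<in> M \<Longrightarrow> (\<And>u. u \<in> N \<Longrightarrow> cinner y u = 0) \<Longrightarrow> y = 0"
  shows "ecdim M \<le> ecdim N"
proof (cases "\<exists>B. finite B \<and> cspan B = N")
  case True
  then obtain B0 where B0: "finite B0" "cspan B0 = N" by blast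
  obtain B where B: "B \<subseteq> N" "complex_vector.independent B" "N \<subseteq> cspan B" "card B = cdim N"
    using complex_vector.basis_exists[of N] by blast
  have fin: "finite B"
    using complex_vector.independent_span_bound[OF B0(1) B(2)] B(1) B0(2) by auto
  have "v = 0" if v: "v \<in> M" "\<forall>b\<in>B. cinner v b = 0" for v
  proof (rule orth[OF v(1)])
    fix u assume "u \<in> N"
    then have "u \<in> cspan B" using B by auto
    then show "cinner v u = 0"
      by (induction rule: complex_vector.span_induct_alt)
        (auto simp: cinner_add_right cinner_scaleC_right v)
  qed
  from finite_spanning_set_if_separated[OF fin M this]
  obtain C where C: "finite C" "card C \<le> card B" "cspan C = M" by auto
  have "cdim M \<le> card C"
    using C by (intro complex_vector.dim_le_card) auto
  then have "cdim M \<le> cdim N" using C B by simp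
  then show ?thesis using C True by (auto simp: ecdim_def)
next
  case False
  then have "ecdim N = \<infinity>" unfolding ecdim_def by (rule if_not_P)
  then show ?thesis by simp
qed

text \<open>The hypotheses describe the ranges of an operator \<open>A\<close> and of \<open>A + B\<close> when
  \<open>\<parallel>Bx\<parallel> \<le> q\<parallel>Ax\<parallel>\<close>. They are not symmetric: in both, the error is measured by the element of \<open>R\<^sub>1\<close>.
  Hence the two inequalities of dimensions have different proofs.\<close>

lemma ecdim_corthogonal_comp_eq:
  fixes R\<^sub>1 R\<^sub>2 :: "'a::complex_hilbert_space set"
  assumes R1: "csubspace R\<^sub>1" and R2: "csubspace R\<^sub>2" and q: "0 \<le> q" "q < 1"
    and to2: "\<And>u. u \<in> R\<^sub>1 \<Longrightarrow> \<exists>v\<in>R\<^sub>2. norm (u - v) \<le> q * norm u"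
    and to1: "\<And>v. v \<in> R\<^sub>2 \<Longrightarrow> \<exists>u\<in>R\<^sub>1. norm (u - v) \<le> q * norm u"
  shows "ecdim (corthogonal_comp R\<^sub>1) = ecdim (corthogonal_comp R\<^sub>2)"
proof (rule antisym;
    rule ecdim_le_if_no_orthogonal[OF csubspace_corthogonal_comp csubspace_corthogonal_comp])
  fix y
  assume y1: "y \<in> corthogonal_comp R\<^sub>1"
    and y2: "\<And>u. u \<in> corthogonal_comp R\<^sub>2 \<Longrightarrow> cinner y u = 0"
  have cl: "y \<in> closure R\<^sub>2" using R2 y2 by (rule in_closure_if_orthogonal_to_comp)
  show "y = 0"
  proof (rule ccontr)
    assume "y \<noteq> 0"
    define k where "k = sqrt (1 - q\<^sup>2)"
    have k: "k > 0" "k\<^sup>2 = 1 - q\<^sup>2" using q abs_square_less_1[of q] by (simp_all add: k_def)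
    obtain v where v: "v \<in> R\<^sub>2" "dist v y < k * norm y"
      using cl \<open>y \<noteq> 0\<close> k by (metis closure_approachable mult_pos_pos zero_less_norm_iff)
    obtain u where u: "u \<in> R\<^sub>1" "norm (u - v) \<le> q * norm u" using to1 v by blast
    have "cinner u y = 0" using y1 u by (auto simp: corthogonal_comp_def)
    then have "(norm (u - y))\<^sup>2 = (norm u)\<^sup>2 + (norm y)\<^sup>2" by (simp add: norm_diff_sq)
    \<comment> \<open>Cauchy--Schwarz in the plane, for the unit vector \<open>(q, k)\<close>\<close>
    moreover have "(q * norm u + k * norm y)\<^sup>2 + (k * norm u - q * norm y)\<^sup>2
        = (norm u)\<^sup>2 + (norm y)\<^sup>2"
    proof -
      have "(q * norm u + k * norm y)\<^sup>2 + (k * norm u - q * norm y)\<^sup>2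
          = (q\<^sup>2 + k\<^sup>2) * ((norm u)\<^sup>2 + (norm y)\<^sup>2)"
        by (simp add: algebra_simps power2_eq_square)
      then show ?thesis using k(2) by simp
    qed
    ultimately have "(q * norm u + k * norm y)\<^sup>2 \<le> (norm (u - y))\<^sup>2"
      using zero_le_power2[of "k * norm u - q * norm y"] by linarith
    then have "q * norm u + k * norm y \<le> norm (u - y)" by (rule power2_le_imp_le) simp
    moreover have "norm (u - y) \<le> norm (u - v) + dist v y"
      using norm_triangle_ineq[of "u - v" "v - y"] by (simp add: dist_norm)
    ultimately show False using u v by linarith
  qed
next
  fix y
  assume y2: "y \<in> corthogonal_comp R\<^sub>2"
    and y1: "\<And>u. u \<in> corthogonal_comp R\<^sub>1 \<Longrightarrow> cinner y u = 0"
  have cl: "y \<in> closure R\<^sub>1" using R1 y1 by (rule in_closure_if_orthogonal_to_comp)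
  show "y = 0"
  proof (rule ccontr)
    assume "y \<noteq> 0"
    define e where "e = (1 - q) * norm y / 2"
    have "e > 0" using \<open>y \<noteq> 0\<close> q by (simp add: e_def)
    then obtain u where u: "u \<in> R\<^sub>1" "dist u y < e" using cl by (metis closure_approachable)
    obtain v where v: "v \<in> R\<^sub>2" "norm (u - v) \<le> q * norm u" using to2 u by blast
    have "cinner v y = 0" using y2 v by (auto simp: corthogonal_comp_def)
    then have "(norm (v - y))\<^sup>2 = (norm v)\<^sup>2 + (norm y)\<^sup>2" by (simp add: norm_diff_sq)
    then have "norm y \<le> norm (v - y)" by - (rule power2_le_imp_le, auto)
    also have "\<dots> \<le> norm (u - v) + dist u y"
      using norm_triangle_ineq4[of "u - y" "u - v"] by (simp add: dist_norm)
    also have "\<dots> < q * (norm y + e) + e"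
    proof -
      have "norm u \<le> norm y + e"
        using norm_triangle_ineq[of y "u - y"] u(2) by (simp add: dist_norm)
      then have "q * norm u \<le> q * (norm y + e)" using q by (simp add: mult_left_mono)
      then show ?thesis using u v by linarith
    qed
    also have "\<dots> \<le> q * norm y + 2 * e"
    proof -
      have "q * e \<le> 1 * e" using q \<open>e > 0\<close> by (intro mult_right_mono) auto
      then show ?thesis by (simp add: algebra_simps)
    qed
    also have "\<dots> = norm y" by (simp add: e_def field_simps)
    finally show False by simp
  qed
qed

section \<open>Hermitian relations far from the real axis\<close>

lemma csubspace_rel_plus:
  assumes T: "csubspace T" and S: "csubspace S"
  shows "csubspace (rel_plus T S)"
proof (rule complex_vector.subspaceI)
  have "(0, 0) \<in> T" "(0, 0) \<in> S"
    using complex_vector.subspace_0[OF T] complex_vector.subspace_0[OF S]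
    by (simp_all add: zero_prod_def)
  then show "0 \<in> rel_plus T S" by (force simp: rel_plus_def zero_prod_def)
next
  fix p q assume "p \<in> rel_plus T S" "q \<in> rel_plus T S"
  then obtain x f g y h k where *: "p = (x, f + g)" "(x, f) \<in> T" "(x, g) \<in> S"
    "q = (y, h + k)" "(y, h) \<in> T" "(y, k) \<in> S" by (auto simp: rel_plus_def)
  have "(x + y, f + h) \<in> T" "(x + y, g + k) \<in> S"
    using complex_vector.subspace_add[OF T *(2,5)] complex_vector.subspace_add[OF S *(3,6)]
    by simp_all
  moreover have "p + q = (x + y, (f + h) + (g + k))" by (simp add: * algebra_simps)
  ultimately show "p + q \<in> rel_plus T S" unfolding rel_plus_def by blast
next
  fix c p assume "p \<in> rel_plus T S"
  then obtain x f g where *: "p = (x, f + g)" "(x, f) \<in> T" "(x, g) \<in> S"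
    by (auto simp: rel_plus_def)
  have "(c *\<^sub>C x, c *\<^sub>C f) \<in> T" "(c *\<^sub>C x, c *\<^sub>C g) \<in> S"
    using complex_vector.subspace_scale[OF T *(2)] complex_vector.subspace_scale[OF S *(3)]
    by (simp_all add: scaleC_prod_def)
  moreover have "c *\<^sub>C p = (c *\<^sub>C x, c *\<^sub>C f + c *\<^sub>C g)"
    by (simp add: * scaleC_prod_def scaleC_add_right)
  ultimately show "c *\<^sub>C p \<in> rel_plus T S" unfolding rel_plus_def by blast
qed

lemma hermitian_subspace_rel_plus:
  assumes "hermitian_subspace T" "hermitian_subspace S"
  shows "hermitian_subspace (rel_plus T S)"
proof -
  have "cinner (f + g) y = cinner x (h + k)"
    if "(x, f) \<in> T" "(x, g) \<in> S" "(y, h) \<in> T" "(y, k) \<in> S" for x f g y h k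
  proof -
    have "cinner f y = cinner x h" "cinner g y = cinner x k"
      using assms that by (fastforce simp: hermitian_subspace_def rel_adjoint_def)+
    then show ?thesis by (simp add: cinner_add_left cinner_add_right)
  qed
  then have "rel_plus T S \<subseteq> rel_adjoint (rel_plus T S)"
    by (auto simp: rel_plus_def rel_adjoint_def)
  then show ?thesis using assms by (simp add: hermitian_subspace_def csubspace_rel_plus)
qed

lemma Range_shift: "Range (rel_plus T (rel_scale c Id)) = {f + c *\<^sub>C x | x f. (x, f) \<in> T}"
  by (auto simp: rel_plus_def rel_scale_def)

lemma csubspace_Range_shift:
  assumes T: "csubspace T"
  shows "csubspace (Range (rel_plus T (rel_scale c Id)))"
proof (rule complex_vector.subspaceI)
  have "(0, 0) \<in> T" using complex_vector.subspace_0[OF T] by (simp add: zero_prod_def)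
  then show "0 \<in> Range (rel_plus T (rel_scale c Id))" by (force simp: Range_shift)
next
  fix u v
  assume "u \<in> Range (rel_plus T (rel_scale c Id))" "v \<in> Range (rel_plus T (rel_scale c Id))"
  then obtain x f y g where *: "u = f + c *\<^sub>C x" "(x, f) \<in> T" "v = g + c *\<^sub>C y" "(y, g) \<in> T"
    by (auto simp: Range_shift)
  have "(x + y, f + g) \<in> T" using complex_vector.subspace_add[OF T *(2,4)] by simp
  moreover have "u + v = (f + g) + c *\<^sub>C (x + y)" by (simp add: * scaleC_add_right)
  ultimately show "u + v \<in> Range (rel_plus T (rel_scale c Id))" unfolding Range_shift by blast
next
  fix a u assume "u \<in> Range (rel_plus T (rel_scale c Id))"
  then obtain x f where *: "u = f + c *\<^sub>C x" "(x, f) \<in> T" by (auto simp: Range_shift)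
  have "(a *\<^sub>C x, a *\<^sub>C f) \<in> T"
    using complex_vector.subspace_scale[OF T *(2)] by (simp add: scaleC_prod_def)
  moreover have "a *\<^sub>C u = a *\<^sub>C f + c *\<^sub>C (a *\<^sub>C x)"
    by (simp add: * scaleC_add_right scaleC_scaleC mult.commute)
  ultimately show "a *\<^sub>C u \<in> Range (rel_plus T (rel_scale c Id))" unfolding Range_shift by blast
qed

lemma norm_hermitian_shift_ge:
  assumes T: "hermitian_subspace T" and xf: "(x, f) \<in> T" and c: "Re c = 0"
  shows "norm f \<le> norm (f + c *\<^sub>C x)" and "cmod c * norm x \<le> norm (f + c *\<^sub>C x)"
proof -
  have "cinner f x = cinner x f"
    using T xf by (fastforce simp: hermitian_subspace_def rel_adjoint_def)
  then have "Im (cinner f x) = 0" using cnj_cinner[of f x] by (simp add: complex_eq_iff)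
  then have "Re (cinner f (c *\<^sub>C x)) = 0" using c by (simp add: cinner_scaleC_right)
  then have "(norm (f + c *\<^sub>C x))\<^sup>2 = (norm f)\<^sup>2 + (cmod c * norm x)\<^sup>2"
    by (simp add: norm_add_sq norm_scaleC)
  then show "norm f \<le> norm (f + c *\<^sub>C x)" "cmod c * norm x \<le> norm (f + c *\<^sub>C x)"
    by - (rule power2_le_imp_le; simp)+
qed

text \<open>Moving the spectral parameter along the imaginary half-axis does not change the
  deficiency. Seen from the point farther out, the shift is a relative contraction however long it
  is, so a single step suffices.\<close>

lemma ecdim_corthogonal_comp_shift_eq:
  fixes T :: "('a::complex_hilbert_space \<times> 'a) set"
  assumes T: "hermitian_subspace T" and c: "Re c = 0" and r: "1 \<le> r"
  shows "ecdim (corthogonal_comp (Range (rel_plus T (rel_scale (of_real r * c) Id))))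
    = ecdim (corthogonal_comp (Range (rel_plus T (rel_scale c Id))))"
proof (rule ecdim_corthogonal_comp_eq)
  have *: "norm ((f + (of_real r * c) *\<^sub>C x) - (f + c *\<^sub>C x))
      \<le> (r - 1) / r * norm (f + (of_real r * c) *\<^sub>C x)" if xf: "(x, f) \<in> T" for x f
  proof -
    have "(f + (of_real r * c) *\<^sub>C x) - (f + c *\<^sub>C x) = (of_real (r - 1) * c) *\<^sub>C x"
      by (simp add: algebra_simps)
    then have "norm ((f + (of_real r * c) *\<^sub>C x) - (f + c *\<^sub>C x)) = (r - 1) * (cmod c * norm x)"
      using r by (simp del: of_real_diff add: norm_scaleC norm_mult)
    also have "\<dots> = (r - 1) / r * (cmod (of_real r * c) * norm x)"
      using r by (simp add: norm_mult)
    also have "\<dots> \<le> (r - 1) / r * norm (f + (of_real r * c) *\<^sub>C x)"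
      using r c by (intro mult_left_mono norm_hermitian_shift_ge(2)[OF T xf]) auto
    finally show ?thesis .
  qed
  have "csubspace T" using T by (simp add: hermitian_subspace_def)
  then show "csubspace (Range (rel_plus T (rel_scale (of_real r * c) Id)))"
    "csubspace (Range (rel_plus T (rel_scale c Id)))"
    by (rule csubspace_Range_shift)+
  show "0 \<le> (r - 1) / r" "(r - 1) / r < 1" using r by simp_all
  show "\<exists>v\<in>Range (rel_plus T (rel_scale c Id)). norm (u - v) \<le> (r - 1) / r * norm u"
    if "u \<in> Range (rel_plus T (rel_scale (of_real r * c) Id))" for u
    using that * unfolding Range_shift by blast
  show "\<exists>u\<in>Range (rel_plus T (rel_scale (of_real r * c) Id)). norm (u - v) \<le> (r - 1) / r * norm u"
    if "v \<in> Range (rel_plus T (rel_scale c Id))" for v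
    using that * unfolding Range_shift by blast
qed

section \<open>Relatively bounded perturbations\<close>

lemma rel_norm_nonneg: "0 \<le> rel_norm T x"
  by (simp add: rel_norm_def infdist_nonneg)

lemma rel_norm_le_norm:
  assumes T: "csubspace T" and xf: "(x, f) \<in> T"
  shows "rel_norm T x \<le> norm f"
proof -
  have "0 \<in> T `` {0}" using complex_vector.subspace_0[OF T] by (simp add: zero_prod_def)
  then show ?thesis using rel_norm_eq[OF T xf] infdist_le[of 0 "T `` {0}" f] by (simp add: dist_norm)
qed

text \<open>The infimum in the norm at \<open>x\<close> need not be attained. Allowing an excess \<open>\<parallel>x\<parallel>\<close> yields a
  genuine value of the relation, and the excess is later absorbed in the coefficient of \<open>\<parallel>x\<parallel>\<close>; at
  \<open>x = 0\<close>, where there is none to spare, the value \<open>0\<close> attains the norm.\<close>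

lemma value_of_almost_minimal_norm:
  assumes S: "csubspace S" and x: "x \<in> Domain S"
  obtains g where "(x, g) \<in> S" "norm g \<le> rel_norm S x + norm x"
proof (cases "x = 0")
  case True
  have "(0, 0) \<in> S" using complex_vector.subspace_0[OF S] by (simp add: zero_prod_def)
  then show ?thesis using that[of 0] True by (simp add: rel_norm_nonneg)
next
  case False
  obtain h where h: "(x, h) \<in> S" using x by blast
  have ne: "S `` {0} \<noteq> {}" using complex_vector.subspace_0[OF S] by (auto simp: zero_prod_def)
  have "infdist h (S `` {0}) < rel_norm S x + norm x"
    using False rel_norm_eq[OF S h] by simp
  then have "(INF a\<in>S `` {0}. dist h a) < rel_norm S x + norm x"
    using ne by (simp add: infdist_notempty)
  then obtain a where a: "(0, a) \<in> S" "dist h a < rel_norm S x + norm x"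
    using ne cInf_lessD[of "dist h ` (S `` {0})"] by blast
  have "(x, h - a) \<in> S" using complex_vector.subspace_diff[OF S h a(1)] by simp
  then show ?thesis using that[of "h - a"] a by (simp add: dist_norm)
qed

lemma rel_bound_less_obtains:
  assumes "rel_bounded T S" "rel_bound T S < B"
  obtains a b where "0 \<le> a" "0 \<le> b" "b < B"
    "\<And>x. x \<in> Domain T \<Longrightarrow> rel_norm S x \<le> a * norm x + b * rel_norm T x"
proof -
  let ?A = "{b. b \<ge> 0 \<and> (\<exists>a\<ge>0. \<forall>x\<in>Domain T. rel_norm S x \<le> a * norm x + b * rel_norm T x)}"
  obtain c where "c \<ge> 0" "\<forall>x\<in>Domain T. rel_norm S x \<le> c * (norm x + rel_norm T x)"
    using assms(1) by (auto simp: rel_bounded_def)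
  then have "c \<in> ?A" by (auto simp: distrib_left)
  then obtain b where "b \<in> ?A" "b < B"
    using assms(2) cInf_lessD[of ?A B] unfolding rel_bound_def by blast
  then show ?thesis using that by blast
qed

text \<open>The multivalued parts match because \<open>S(0) \<subseteq> T(0)\<close>: whatever value of \<open>S\<close> enters an element of
  \<open>T + S\<close>, it can be replaced by one of almost minimal norm, the difference being
  moved to \<open>T\<close>.\<close>

lemma ecdim_corthogonal_comp_perturbation_eq:
  fixes T S :: "('a::complex_hilbert_space \<times> 'a) set"
  assumes T: "hermitian_subspace T" and S: "csubspace S"
    and dom: "Domain T \<subseteq> Domain S" and mul: "S `` {0} \<subseteq> T `` {0}"
    and c: "Re c = 0" "c \<noteq> 0" and a: "0 \<le> a" and b: "0 \<le> b" and lt: "(a + 1) / cmod c + b < 1"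
    and bound: "\<And>x. x \<in> Domain T \<Longrightarrow> rel_norm S x \<le> a * norm x + b * rel_norm T x"
  shows "ecdim (corthogonal_comp (Range (rel_plus T (rel_scale c Id))))
    = ecdim (corthogonal_comp (Range (rel_plus (rel_plus T S) (rel_scale c Id))))"
proof (rule ecdim_corthogonal_comp_eq)
  let ?q = "(a + 1) / cmod c + b"
  have cT: "csubspace T" using T by (simp add: hermitian_subspace_def)
  have *: "norm g \<le> ?q * norm (f + c *\<^sub>C x)"
    if xf: "(x, f) \<in> T" and g: "norm g \<le> rel_norm S x + norm x" for x f g
  proof -
    have "norm g \<le> a * norm x + b * rel_norm T x + norm x"
      using bound[of x] xf g by force
    also have "\<dots> \<le> (a + 1) * norm x + b * norm f"
      using mult_left_mono[OF rel_norm_le_norm[OF cT xf] b] by (simp add: algebra_simps)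
    also have "\<dots> = (a + 1) / cmod c * (cmod c * norm x) + b * norm f" using c by simp
    also have "\<dots> \<le> (a + 1) / cmod c * norm (f + c *\<^sub>C x) + b * norm (f + c *\<^sub>C x)"
      using a b norm_hermitian_shift_ge[OF T xf c(1)]
      by (intro add_mono mult_left_mono) auto
    finally show ?thesis by (simp add: distrib_right)
  qed
  show "0 \<le> ?q" using a b by simp
  show "?q < 1" by (rule lt)
  show "csubspace (Range (rel_plus T (rel_scale c Id)))"
    "csubspace (Range (rel_plus (rel_plus T S) (rel_scale c Id)))"
    by (intro csubspace_Range_shift csubspace_rel_plus cT S)+
  show "\<exists>v\<in>Range (rel_plus (rel_plus T S) (rel_scale c Id)). norm (u - v) \<le> ?q * norm u"
    if u: "u \<in> Range (rel_plus T (rel_scale c Id))" for u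
  proof -
    obtain x f where xf: "(x, f) \<in> T" "u = f + c *\<^sub>C x" using u by (auto simp: Range_shift)
    then have "x \<in> Domain S" using dom by blast
    then obtain g where g: "(x, g) \<in> S" "norm g \<le> rel_norm S x + norm x"
      by (rule value_of_almost_minimal_norm[OF S])
    have "(x, f + g) \<in> rel_plus T S" using xf g by (auto simp: rel_plus_def)
    then have "(f + g) + c *\<^sub>C x \<in> Range (rel_plus (rel_plus T S) (rel_scale c Id))"
      unfolding Range_shift by blast
    moreover have "norm (u - ((f + g) + c *\<^sub>C x)) = norm g" by (simp add: xf)
    ultimately show ?thesis using *[OF xf(1) g(2)] xf(2) by metis
  qed
  show "\<exists>u\<in>Range (rel_plus T (rel_scale c Id)). norm (u - v) \<le> ?q * norm u"
    if v: "v \<in> Range (rel_plus (rel_plus T S) (rel_scale c Id))" for v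
  proof -
    obtain x f h where xf: "(x, f) \<in> T" "(x, h) \<in> S" "v = (f + h) + c *\<^sub>C x"
      using v unfolding Range_shift by (auto simp: rel_plus_def)
    then have "x \<in> Domain S" by blast
    then obtain g where g: "(x, g) \<in> S" "norm g \<le> rel_norm S x + norm x"
      by (rule value_of_almost_minimal_norm[OF S])
    have "(0, h - g) \<in> S" using complex_vector.subspace_diff[OF S xf(2) g(1)] by simp
    then have "(0, h - g) \<in> T" using mul by blast
    then have f': "(x, f + (h - g)) \<in> T" using complex_vector.subspace_add[OF cT xf(1)] by fastforce
    then have "(f + (h - g)) + c *\<^sub>C x \<in> Range (rel_plus T (rel_scale c Id))"
      unfolding Range_shift by blast
    moreover have "norm (((f + (h - g)) + c *\<^sub>C x) - v) = norm g" by (simp add: xf)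
    ultimately show ?thesis using *[OF f' g(2)] by metis
  qed
qed

theorem corollary3p1:
  fixes T S :: "('a::complex_hilbert_space \<times> 'a) set"
  assumes "hermitian_subspace T" and "hermitian_subspace S"
    and "Domain T \<subseteq> Domain S" and "S `` {0} \<subseteq> T `` {0}"
    and "rel_bounded T S" and "rel_bound T S < 1"
  shows "deficiency_plus (rel_plus T S) = deficiency_plus T \<and>
    deficiency_minus (rel_plus T S) = deficiency_minus T"
proof -
  obtain a b where ab: "0 \<le> a" "0 \<le> b" "b < 1"
    and bound: "\<And>x. x \<in> Domain T \<Longrightarrow> rel_norm S x \<le> a * norm x + b * rel_norm T x"
    using rel_bound_less_obtains[OF assms(5,6)] by blast
  \<comment> \<open>the contraction factor at \<open>\<plusminus>ir\<close> is then at most \<open>(1 + b) / 2\<close>\<close>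
  define r where "r = max 1 (2 * (a + 1) / (1 - b))"
  have r: "1 \<le> r" by (simp add: r_def)
  have "2 * (a + 1) / (1 - b) \<le> r" by (simp add: r_def)
  then have "(a + 1) / r \<le> (1 - b) / 2" using ab r by (simp add: field_simps)
  also have "(1 - b) / 2 < 1 - b" using ab by simp
  finally have lt: "(a + 1) / r + b < 1" by (simp only: less_diff_eq)
  have S: "csubspace S" using assms(2) by (simp add: hermitian_subspace_def)
  have TS: "hermitian_subspace (rel_plus T S)"
    using assms(1,2) by (rule hermitian_subspace_rel_plus)
  have "ecdim (corthogonal_comp (Range (rel_plus (rel_plus T S) (rel_scale c Id))))
      = ecdim (corthogonal_comp (Range (rel_plus T (rel_scale c Id))))"
    if c: "Re c = 0" "cmod c = 1" for c
  proof -
    have cr: "Re (of_real r * c) = 0" "of_real r * c \<noteq> 0" "cmod (of_real r * c) = r"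
      using c r by (auto simp: norm_mult)
    have "ecdim (corthogonal_comp (Range (rel_plus T (rel_scale (of_real r * c) Id))))
      = ecdim (corthogonal_comp (Range (rel_plus (rel_plus T S) (rel_scale (of_real r * c) Id))))"
      using ecdim_corthogonal_comp_perturbation_eq[OF assms(1) S assms(3,4) cr(1,2) ab(1,2) _ bound]
        lt cr(3) by simp
    then show ?thesis
      using ecdim_corthogonal_comp_shift_eq[OF assms(1) c(1) r]
        ecdim_corthogonal_comp_shift_eq[OF TS c(1) r] by simp
  qed
  from this[of "- \<i>"] this[of "\<i>"] show ?thesis
    by (simp add: deficiency_plus_def deficiency_minus_def)
qed

end
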